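(* Let $k\geq 1$ and $n$ be positive integers with $2k-1\leq n$. Let $\mathcal{A}$ be a family of $(k-1)$-element subsets of $[n]=\{1,\dots,n\}$, and let $\mathcal{B}$ be a family of $k$-element subsets of $[n]$. Suppose that $\mathcal{A}$ and $\mathcal{B}$ are cross-intersecting, that $\mathcal{B}$ is nonempty, and that $\partial\mathcal{B}\subseteq\mathcal{A}$. Then \[ |\mathcal{A}|+|\mathcal{B}|\leq \binom{n}{k-1}-\binom{n-k}{k-1}+1. \]
   Context: Two set families $\mathcal{A}$ and $\mathcal{B}$ are cross-intersecting if $A\cap B\neq\emptyset$ for every $A\in\mathcal{A}$ and $B\in\mathcal{B}$. The shadow $\partial B$ of a $k$-element set $B$ is the family of all $(k-1)$-element subsets of $B$; the shadow $\partial\mathcal{B}$ of a family $\mathcal{B}$ of $k$-element sets is the union of the shadows of its members. *)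

theory Defs
  imports Main
begin

definition cross_intersecting :: "'a set set \<Rightarrow> 'a set set \<Rightarrow> bool" where
  "cross_intersecting \<A> \<B> \<longleftrightarrow> (\<forall>A\<in>\<A>. \<forall>B\<in>\<B>. A \<inter> B \<noteq> {})"

(* "card C + 1 = card B" rather than "card C = card B - 1": with truncated
   subtraction the empty set would lie in its own shadow. *)
definition set_shadow :: "'a set \<Rightarrow> 'a set set" where
  "set_shadow B = {C. C \<subseteq> B \<and> card C + 1 = card B}"

definition shadow :: "'a set set \<Rightarrow> 'a set set" where
  "shadow \<B> = (\<Union>B\<in>\<B>. set_shadow B)"

end

theory Submission
  imports Defs
begin

text \<open>
  Induction on the size of the ground set, splitting both families at a point \<open>x\<close>. Shifting
  \<open>x\<close> to every other point preserves the cardinalities, the cross-intersection and the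
  shadow condition, so one may assume that both families are stable under these shifts.
  Since the ground set has more than \<open>2k - 1\<close> points, stability makes the links at \<open>x\<close> cross-intersecting
  again, and it makes the deletion of \<open>\<B>\<close> nonempty; Pascal's rule then adds up the two
  inductive bounds. If the link of \<open>\<B>\<close> is empty, the link of \<open>\<A>\<close> consists of sets that meet a
  fixed member of \<open>\<B>\<close>. For ground sets of size \<open>2k - 1\<close>, the complements of the members of
  \<open>\<B>\<close> have size \<open>k - 1\<close> and avoid \<open>\<A>\<close>.
\<close>

section \<open>Shifting a point \<open>x\<close> to a point \<open>i\<close>\<close>

definition shift :: "'a \<Rightarrow> 'a \<Rightarrow> 'a set set \<Rightarrow> 'a set set" where
  "shift i x \<F> =
     (\<lambda>C. if x \<in> C \<and> i \<notin> C \<and> insert i (C - {x}) \<notin> \<F> then insert i (C - {x}) else C) ` \<F>"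

lemma insert_Diff_swap: "x \<in> C \<Longrightarrow> i \<notin> C \<Longrightarrow> insert x (insert i (C - {x}) - {i}) = C"
  by auto

text \<open>Exchanging \<open>x\<close> and \<open>i\<close> pairs off the sets that contain exactly
  one of the two points. From each pair the shift keeps as many sets as \<open>\<F>\<close> has, but
  prefers the one with \<open>i\<close>: the set with \<open>x\<close> survives only if its partner
  is present too. All other sets are untouched.\<close>

lemma mem_shift_iff:
  assumes "i \<noteq> x"
  shows "C \<in> shift i x \<F> \<longleftrightarrow>
    C \<in> \<F> \<and> (x \<in> C \<and> i \<notin> C \<longrightarrow> insert i (C - {x}) \<in> \<F>) \<or>
    i \<in> C \<and> x \<notin> C \<and> insert x (C - {i}) \<in> \<F>" (is "_ \<longleftrightarrow> ?R")
proof
  assume "C \<in> shift i x \<F>"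
  then obtain D where D: "D \<in> \<F>"
    "C = (if x \<in> D \<and> i \<notin> D \<and> insert i (D - {x}) \<notin> \<F> then insert i (D - {x}) else D)"
    unfolding shift_def by blast
  show ?R
  proof (cases "x \<in> D \<and> i \<notin> D \<and> insert i (D - {x}) \<notin> \<F>")
    case True
    then show ?thesis using D assms insert_Diff_swap[of x D i] by auto
  next
    case False
    then show ?thesis using D by auto
  qed
next
  assume ?R
  then consider "C \<in> \<F>" "x \<in> C \<and> i \<notin> C \<longrightarrow> insert i (C - {x}) \<in> \<F>"
    | "C \<notin> \<F>" "i \<in> C" "x \<notin> C" "insert x (C - {i}) \<in> \<F>"
    by blast
  then show "C \<in> shift i x \<F>"
  proof cases
    case 1
    then show ?thesis unfolding shift_def by (intro image_eqI[of _ _ C]) auto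
  next
    case 2
    have "insert i (insert x (C - {i}) - {x}) = C"
      using 2 insert_Diff_swap[of i C x] by simp
    then show ?thesis unfolding shift_def
      using 2 assms by (intro image_eqI[of _ _ "insert x (C - {i})"]) auto
  qed
qed

lemma card_shift:
  assumes "i \<noteq> x"
  shows "card (shift i x \<F>) = card \<F>"
  unfolding shift_def
proof (rule card_image, rule inj_onI)
  fix C D
  assume "C \<in> \<F>" "D \<in> \<F>"
    and "(if x \<in> C \<and> i \<notin> C \<and> insert i (C - {x}) \<notin> \<F> then insert i (C - {x}) else C) =
         (if x \<in> D \<and> i \<notin> D \<and> insert i (D - {x}) \<notin> \<F> then insert i (D - {x}) else D)"
  then show "C = D"
    by (metis insert_Diff_swap)
qed

text \<open>No set containing \<open>x\<close> is ever created. The number of such sets serves below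
  as the quantity to minimise.\<close>

lemma card_shift_mem_le:
  assumes "finite \<F>" "i \<noteq> x"
  shows "card {C \<in> shift i x \<F>. x \<in> C} \<le> card {C \<in> \<F>. x \<in> C}"
  using assms by (intro card_mono) (auto simp: mem_shift_iff split: if_splits)

lemma card_shift_mem_less:
  assumes "finite \<F>" "i \<noteq> x" "C \<in> \<F>" "x \<in> C" "i \<notin> C" "insert i (C - {x}) \<notin> \<F>"
  shows "card {C \<in> shift i x \<F>. x \<in> C} < card {C \<in> \<F>. x \<in> C}"
proof (rule psubset_card_mono)
  have "C \<notin> shift i x \<F>"
    using assms by (simp add: mem_shift_iff)
  moreover have "{C \<in> shift i x \<F>. x \<in> C} \<subseteq> {C \<in> \<F>. x \<in> C}"
    using assms(2) by (auto simp: mem_shift_iff split: if_splits)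
  ultimately show "{C \<in> shift i x \<F>. x \<in> C} \<subset> {C \<in> \<F>. x \<in> C}"
    using assms(3,4) by blast
qed (use assms(1) in simp)

lemma finite_uniform:
  assumes "finite V" "\<F> \<subseteq> {C. C \<subseteq> V \<and> card C = k}"
  shows "finite \<F>"
  using assms by (intro finite_subset[of \<F> "Pow V"]) auto

lemma shift_uniform:
  assumes "finite V" "i \<in> V" "\<F> \<subseteq> {C. C \<subseteq> V \<and> card C = k}"
  shows "shift i x \<F> \<subseteq> {C. C \<subseteq> V \<and> card C = k}"
proof
  fix C assume "C \<in> shift i x \<F>"
  then obtain D where D: "D \<in> \<F>" "C = D \<or> x \<in> D \<and> i \<notin> D \<and> C = insert i (D - {x})"
    unfolding shift_def by (auto split: if_splits)
  then have D': "D \<subseteq> V" "card D = k" using assms(3) by auto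
  moreover have "finite D" using D'(1) assms(1) by (rule finite_subset)
  ultimately show "C \<in> {C. C \<subseteq> V \<and> card C = k}"
    using D(2) assms(2) card_Suc_Diff1[of D x] by auto
qed

text \<open>Two disjoint members of the shifts cannot both be new, since new sets contain
  \<open>i\<close>, and they cannot both be old. So one is new and arises from a swap. If the other
  lacks \<open>x\<close>, it is already disjoint from the preimage of the new one. If it contains
  \<open>x\<close>, it survived because its own swap is present, and exchanging \<open>x\<close> and
  \<open>i\<close> in both sets preserves disjointness.\<close>

lemma cross_intersecting_shift:
  assumes "i \<noteq> x" "cross_intersecting \<A> \<B>"
  shows "cross_intersecting (shift i x \<A>) (shift i x \<B>)"
  unfolding cross_intersecting_def
proof (intro ballI notI)
  have cross: "A \<inter> B \<noteq> {}" if "A \<in> \<A>" "B \<in> \<B>" for A B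
    using assms(2) that unfolding cross_intersecting_def by blast
  fix A B
  assume A: "A \<in> shift i x \<A>" and B: "B \<in> shift i x \<B>" and AB: "A \<inter> B = {}"
  show False
  proof (cases "A \<in> \<A> \<and> (x \<in> A \<and> i \<notin> A \<longrightarrow> insert i (A - {x}) \<in> \<A>)")
    case True
    then have "B \<notin> \<B>" using AB cross by blast
    then have b: "i \<in> B" "x \<notin> B" "insert x (B - {i}) \<in> \<B>"
      using B assms(1) by (auto simp: mem_shift_iff)
    show False
    proof (cases "x \<in> A")
      case xA: True
      then have "insert i (A - {x}) \<inter> insert x (B - {i}) \<noteq> {}"
        using True b AB by (intro cross) auto
      then show False using AB assms(1) by auto
    next
      case False
      then show False using cross[of A "insert x (B - {i})"] True b AB by auto
    qed
  next
    case False
    then have a: "i \<in> A" "x \<notin> A" "insert x (A - {i}) \<in> \<A>"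
      using A assms(1) by (auto simp: mem_shift_iff)
    then have "i \<notin> B" using AB by blast
    then have b: "B \<in> \<B>" "x \<in> B \<Longrightarrow> insert i (B - {x}) \<in> \<B>"
      using B assms(1) by (auto simp: mem_shift_iff)
    show False
    proof (cases "x \<in> B")
      case True
      then show False
        using cross[OF a(3) b(2)] AB assms(1) by auto
    next
      case False
      then show False using cross[OF a(3) b(1)] AB by auto
    qed
  qed
qed

lemma shadow_shift:
  assumes "i \<noteq> x" and sh: "\<And>B y. B \<in> \<B> \<Longrightarrow> y \<in> B \<Longrightarrow> B - {y} \<in> \<A>"
    and B: "B \<in> shift i x \<B>" and y: "y \<in> B"
  shows "B - {y} \<in> shift i x \<A>"
proof -
  show ?thesis
  proof (cases "B \<in> \<B> \<and> (x \<in> B \<and> i \<notin> B \<longrightarrow> insert i (B - {x}) \<in> \<B>)")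
    case True
    have "insert i (B - {y} - {x}) \<in> \<A>" if "x \<in> B - {y}" "i \<notin> B - {y}"
    proof (cases "i \<in> B")
      case iB: True
      \<comment> \<open>Here \<open>y = i\<close>, so the swap of \<open>B - {y}\<close> is another
        member of the shadow of \<open>B\<close>.\<close>
      then have "insert i (B - {y} - {x}) = B - {x}" using that assms(1) by auto
      then show ?thesis using sh[of B x] True that by auto
    next
      case False
      then have "insert i (B - {y} - {x}) = insert i (B - {x}) - {y}" using y by auto
      then show ?thesis using sh[of "insert i (B - {x})" y] True False that y by auto
    qed
    then show ?thesis
      using sh[of B y] True y unfolding mem_shift_iff[OF assms(1)] by blast
  next
    case False
    then have b: "i \<in> B" "x \<notin> B" "insert x (B - {i}) \<in> \<B>"
      using B assms(1) by (auto simp: mem_shift_iff)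
    show ?thesis
    proof (cases "y = i")
      case True
      \<comment> \<open>Removing \<open>i\<close> from the new set is the same as removing
        \<open>x\<close> from its preimage; the result has neither point, so the shift leaves it
        alone.\<close>
      have "B - {i} = insert x (B - {i}) - {x}" using b by auto
      then have "B - {i} \<in> \<A>" using sh[OF b(3), of x] by simp
      then show ?thesis using True b(2) unfolding mem_shift_iff[OF assms(1)] by blast
    next
      case False
      have "insert x (B - {y} - {i}) = insert x (B - {i}) - {y}" using b y by auto
      then have "insert x (B - {y} - {i}) \<in> \<A>" using sh[OF b(3), of y] y False by simp
      then show ?thesis using False b unfolding mem_shift_iff[OF assms(1)] by blast
    qed
  qed
qed

text \<open>Here \<open>k\<close> is the size of the members of \<open>\<A>\<close>, that is, \<open>k - 1\<close> in the theorem.\<close>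

definition cross_shadow_pair :: "'a set \<Rightarrow> nat \<Rightarrow> 'a set set \<Rightarrow> 'a set set \<Rightarrow> bool" where
  "cross_shadow_pair V k \<A> \<B> \<longleftrightarrow>
     \<A> \<subseteq> {A. A \<subseteq> V \<and> card A = k} \<and> \<B> \<subseteq> {B. B \<subseteq> V \<and> card B = Suc k} \<and>
     cross_intersecting \<A> \<B> \<and> \<B> \<noteq> {} \<and> (\<forall>B\<in>\<B>. \<forall>y\<in>B. B - {y} \<in> \<A>)"

section \<open>Passing to a pair that is stable under shifts away from \<open>x\<close>\<close>

lemma cross_shadow_pair_shift:
  assumes "finite V" "i \<in> V" "i \<noteq> x" "cross_shadow_pair V k \<A> \<B>"
  shows "cross_shadow_pair V k (shift i x \<A>) (shift i x \<B>)"
  unfolding cross_shadow_pair_def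
proof (intro conjI ballI)
  have "\<B> \<noteq> {}" using assms(4) unfolding cross_shadow_pair_def by simp
  then show "shift i x \<B> \<noteq> {}" unfolding shift_def by blast
  fix B y assume "B \<in> shift i x \<B>" "y \<in> B"
  then show "B - {y} \<in> shift i x \<A>"
    using shadow_shift[of i x \<B> \<A> B y] assms unfolding cross_shadow_pair_def by blast
next
  show "shift i x \<A> \<subseteq> {A. A \<subseteq> V \<and> card A = k}" "shift i x \<B> \<subseteq> {B. B \<subseteq> V \<and> card B = Suc k}"
    using assms(4) unfolding cross_shadow_pair_def
    by (simp_all only: shift_uniform[OF assms(1,2)])
  show "cross_intersecting (shift i x \<A>) (shift i x \<B>)"
    using assms(4) unfolding cross_shadow_pair_def
    by (intro cross_intersecting_shift[OF assms(3)]) simp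
qed

text \<open>Among all pairs with the given cardinalities, take one in which the fewest members
  contain \<open>x\<close>, counted over both families together. If some shift from \<open>x\<close>
  moved a member of either family, shifting both families would lower this count.\<close>

lemma cross_shadow_pair_stable_ex:
  assumes "finite V" "cross_shadow_pair V k \<A> \<B>"
  obtains \<A>' \<B>' where "cross_shadow_pair V k \<A>' \<B>'" "card \<A>' = card \<A>" "card \<B>' = card \<B>"
    "\<And>i A. i \<in> V \<Longrightarrow> A \<in> \<A>' \<Longrightarrow> x \<in> A \<Longrightarrow> i \<notin> A \<Longrightarrow> insert i (A - {x}) \<in> \<A>'"
    "\<And>i B. i \<in> V \<Longrightarrow> B \<in> \<B>' \<Longrightarrow> x \<in> B \<Longrightarrow> i \<notin> B \<Longrightarrow> insert i (B - {x}) \<in> \<B>'"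
proof -
  define P where "P = (\<lambda>(\<A>', \<B>'). cross_shadow_pair V k \<A>' \<B>' \<and>
    card \<A>' = card \<A> \<and> card \<B>' = card \<B>)"
  define w where "w = (\<lambda>(\<A>', \<B>'). card {A \<in> \<A>'. x \<in> A} + card {B \<in> \<B>'. x \<in> B})"
  have "P (\<A>, \<B>)" using assms unfolding P_def by simp
  then obtain p where p: "P p" "\<And>q. P q \<Longrightarrow> w p \<le> w q"
    using ex_has_least_nat[of P "(\<A>, \<B>)" w] by blast
  obtain \<A>' \<B>' where pe: "p = (\<A>', \<B>')" by (cases p)
  have pr: "cross_shadow_pair V k \<A>' \<B>'" "card \<A>' = card \<A>" "card \<B>' = card \<B>"
    using p(1) unfolding pe P_def by auto
  have fin: "finite \<A>'" "finite \<B>'"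
    using pr(1) finite_uniform[OF assms(1), of \<A>' k] finite_uniform[OF assms(1), of \<B>' "Suc k"]
    unfolding cross_shadow_pair_def by simp_all
  have le: "card {A \<in> \<A>'. x \<in> A} + card {B \<in> \<B>'. x \<in> B} \<le>
    card {A \<in> shift i x \<A>'. x \<in> A} + card {B \<in> shift i x \<B>'. x \<in> B}"
    if "i \<in> V" "i \<noteq> x" for i
  proof -
    have "P (shift i x \<A>', shift i x \<B>')"
      using cross_shadow_pair_shift[OF assms(1) that pr(1)] pr card_shift[OF that(2)]
      unfolding P_def by simp
    from p(2)[OF this] show ?thesis unfolding pe w_def by simp
  qed
  show ?thesis
  proof (rule that[OF pr])
    fix i A assume *: "i \<in> V" "A \<in> \<A>'" "x \<in> A" "i \<notin> A"
    then have "i \<noteq> x" by auto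
    then show "insert i (A - {x}) \<in> \<A>'"
      using le[of i] card_shift_mem_less[OF fin(1), of i x A] card_shift_mem_le[OF fin(2), of i x] *
      by fastforce
  next
    fix i B assume *: "i \<in> V" "B \<in> \<B>'" "x \<in> B" "i \<notin> B"
    then have "i \<noteq> x" by auto
    then show "insert i (B - {x}) \<in> \<B>'"
      using le[of i] card_shift_mem_less[OF fin(2), of i x B] card_shift_mem_le[OF fin(1), of i x] *
      by fastforce
  qed
qed

section \<open>Bounds for the extreme cases\<close>

text \<open>For \<open>k = 0\<close> the shadow of a singleton would put the empty set into
  \<open>\<A>\<close>, and the empty set meets nothing. The induction therefore never reaches
  \<open>k = 0\<close>.\<close>

lemma cross_shadow_pair_pos:
  assumes "cross_shadow_pair V k \<A> \<B>"
  shows "0 < k"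
proof (rule ccontr)
  assume "\<not> 0 < k"
  obtain B where B: "B \<in> \<B>" "card B = Suc 0"
    using assms \<open>\<not> 0 < k\<close> unfolding cross_shadow_pair_def by auto
  then obtain y where "B = {y}" by (auto simp: card_Suc_eq)
  then have "{} \<in> \<A>" using assms B unfolding cross_shadow_pair_def by fastforce
  then show False using assms B unfolding cross_shadow_pair_def cross_intersecting_def by fastforce
qed

text \<open>The \<open>k\<close>-element subsets of \<open>V - B\<close> miss \<open>B\<close>, so
  none of them lies in \<open>\<F>\<close>.\<close>

lemma card_meeting_le:
  assumes "finite V" "B \<subseteq> V" "\<F> \<subseteq> {C. C \<subseteq> V \<and> card C = k}" "\<And>C. C \<in> \<F> \<Longrightarrow> C \<inter> B \<noteq> {}"
  shows "card \<F> + ((card V - card B) choose k) \<le> card V choose k"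
proof -
  let ?D = "{C. C \<subseteq> V - B \<and> card C = k}"
  have fin: "finite B" "finite (V - B)" using assms finite_subset by auto
  have finD: "finite ?D" using fin by simp
  have finF: "finite \<F>"
    using finite_uniform[OF assms(1,3)] .
  have "card \<F> + card ?D = card (\<F> \<union> ?D)"
    using assms(4) by (intro card_Un_disjoint[symmetric] finF finD) blast
  also have "\<dots> \<le> card {C. C \<subseteq> V \<and> card C = k}"
    using assms by (intro card_mono) auto
  finally show ?thesis
    using n_subsets[OF assms(1)] n_subsets[OF fin(2)] card_Diff_subset[OF fin(1) assms(2)] by simp
qed

lemma cross_intersecting_card_le:
  assumes "finite V" "card V = k + l"
    and A: "\<A> \<subseteq> {A. A \<subseteq> V \<and> card A = k}" and B: "\<B> \<subseteq> {B. B \<subseteq> V \<and> card B = l}"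
    and cross: "cross_intersecting \<A> \<B>"
  shows "card \<A> + card \<B> \<le> card V choose k"
proof -
  let ?C = "(\<lambda>B. V - B) ` \<B>"
  have fin: "finite \<A>" "finite \<B>"
    using finite_uniform[OF assms(1) A] finite_uniform[OF assms(1) B] .
  have C: "?C \<subseteq> {A. A \<subseteq> V \<and> card A = k}"
    using B assms(1,2) by (auto simp: card_Diff_subset finite_subset)
  have "inj_on (\<lambda>B. V - B) \<B>"
    using B by (intro inj_onI) blast
  then have "card \<A> + card \<B> = card \<A> + card ?C" by (simp add: card_image)
  also have "\<dots> = card (\<A> \<union> ?C)"
    using cross unfolding cross_intersecting_def
    by (intro card_Un_disjoint[symmetric]) (use fin in auto)
  also have "\<dots> \<le> card {A. A \<subseteq> V \<and> card A = k}"
    using A C assms(1) by (intro card_mono) auto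
  finally show ?thesis using n_subsets[OF assms(1)] by simp
qed

lemma card_deletion_link:
  assumes "finite \<F>"
  shows "card \<F> = card {C \<in> \<F>. x \<notin> C} + card ((\<lambda>C. C - {x}) ` {C \<in> \<F>. x \<in> C})"
proof -
  have "inj_on (\<lambda>C. C - {x}) {C \<in> \<F>. x \<in> C}"
    by (intro inj_onI) blast
  moreover have "\<F> = {C \<in> \<F>. x \<notin> C} \<union> {C \<in> \<F>. x \<in> C}" by auto
  then have "card \<F> = card {C \<in> \<F>. x \<notin> C} + card {C \<in> \<F>. x \<in> C}"
    using assms by (metis (no_types, lifting) card_Un_disjoint disjoint_iff finite_Un mem_Collect_eq)
  ultimately show ?thesis by (simp add: card_image)
qed

section \<open>The induction on the ground set\<close>

text \<open>The subtracted binomial stands on the left, so that the inequality is meaningful in the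
  natural numbers. The set \<open>V\<close> and the size \<open>k\<close> vary in the induction: the
  deletion at \<open>x\<close> keeps \<open>k\<close>, the link lowers it by one, and both live on
  \<open>V - {x}\<close>.\<close>

theorem cross_shadow_pair_card_le:
  assumes "finite V" "2 * k + 1 \<le> card V" "cross_shadow_pair V k \<A> \<B>"
  shows "card \<A> + card \<B> + ((card V - Suc k) choose k) \<le> (card V choose k) + 1"
  using assms
proof (induction "card V" arbitrary: V k \<A> \<B> rule: less_induct)
  case less
  show ?case
  proof (cases "card V = 2 * k + 1")
    \<comment> \<open>Here \<open>card V - Suc k = k\<close>, so the binomial on the left is 1 and
      cancels the \<open>+ 1\<close>.\<close>
    case True
    then show ?thesis
      using cross_intersecting_card_le[of V k "Suc k" \<A> \<B>] less.prems
      unfolding cross_shadow_pair_def by simp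
  next
    case False
    then have big: "2 * k + 2 \<le> card V" using less.prems by simp
    have "0 < k" using less.prems(3) by (rule cross_shadow_pair_pos)
    then obtain l where k: "k = Suc l" by (cases k) auto
    \<comment> \<open>With this \<open>m\<close>, the number of points outside a member of
      \<open>\<B>\<close> is \<open>m + 1\<close>, and it is \<open>m\<close> for a member of the
      deletion inside \<open>V - {x}\<close>.\<close>
    obtain m where m: "card V = m + k + 2" "k \<le> m"
      using big by (intro that[of "card V - k - 2"]) auto
    obtain x where x: "x \<in> V" using m by fastforce
    obtain \<A>' \<B>' where pair: "cross_shadow_pair V k \<A>' \<B>'"
      and cards: "card \<A>' = card \<A>" "card \<B>' = card \<B>"
      and stA: "\<And>i A. i \<in> V \<Longrightarrow> A \<in> \<A>' \<Longrightarrow> x \<in> A \<Longrightarrow> i \<notin> A \<Longrightarrow> insert i (A - {x}) \<in> \<A>'"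
      and stB: "\<And>i B. i \<in> V \<Longrightarrow> B \<in> \<B>' \<Longrightarrow> x \<in> B \<Longrightarrow> i \<notin> B \<Longrightarrow> insert i (B - {x}) \<in> \<B>'"
      using cross_shadow_pair_stable_ex[OF less.prems(1,3), of x] by metis
    have A: "A \<subseteq> V" "card A = k" if "A \<in> \<A>'" for A
      using pair that unfolding cross_shadow_pair_def by auto
    have B: "B \<subseteq> V" "card B = Suc k" if "B \<in> \<B>'" for B
      using pair that unfolding cross_shadow_pair_def by auto
    have finA: "finite A" if "A \<in> \<A>'" for A
      using A(1)[OF that] less.prems(1) by (rule finite_subset)
    have finB: "finite B" if "B \<in> \<B>'" for B
      using B(1)[OF that] less.prems(1) by (rule finite_subset)
    have cross: "A \<inter> B \<noteq> {}" if "A \<in> \<A>'" "B \<in> \<B>'" for A B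
      using pair that unfolding cross_shadow_pair_def cross_intersecting_def by blast
    have sh: "B - {y} \<in> \<A>'" if "B \<in> \<B>'" "y \<in> B" for B y
      using pair that unfolding cross_shadow_pair_def by blast
    have fin: "finite \<A>'" "finite \<B>'"
      using pair finite_uniform[OF less.prems(1), of \<A>' k]
        finite_uniform[OF less.prems(1), of \<B>' "Suc k"]
      unfolding cross_shadow_pair_def by simp_all
    let ?V = "V - {x}"
    have V: "finite ?V" "card ?V = m + k + 1" "card ?V < card V"
      using less.prems(1) m x by auto
    let ?A0 = "{A \<in> \<A>'. x \<notin> A}" and ?B0 = "{B \<in> \<B>'. x \<notin> B}"
    let ?A1 = "(\<lambda>A. A - {x}) ` {A \<in> \<A>'. x \<in> A}" and ?B1 = "(\<lambda>B. B - {x}) ` {B \<in> \<B>'. x \<in> B}"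
    have B0: "?B0 \<noteq> {}"
    proof -
      obtain B where b: "B \<in> \<B>'" using pair unfolding cross_shadow_pair_def by blast
      have "card B < card V" using B[OF b] m by simp
      then obtain i where i: "i \<in> V" "i \<notin> B"
        using card_mono[OF finB[OF b], of V] by fastforce
      show ?thesis
      proof (cases "x \<in> B")
        case True
        then have "insert i (B - {x}) \<in> ?B0" using stB[OF i(1) b True i(2)] i by auto
        then show ?thesis by blast
      qed (use b in blast)
    qed
    have dp: "cross_shadow_pair ?V k ?A0 ?B0"
      unfolding cross_shadow_pair_def cross_intersecting_def
    proof (intro conjI ballI)
      show "?A0 \<subseteq> {A. A \<subseteq> ?V \<and> card A = k}" using A by auto
      show "?B0 \<subseteq> {B. B \<subseteq> ?V \<and> card B = Suc k}" using B by auto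
    qed (use B0 cross sh in auto)
    have del: "card ?A0 + card ?B0 + (m choose k) \<le> ((m + k + 1) choose k) + 1"
      using less.hyps[OF V(3) V(1) _ dp] V(2) m by simp
    have A1: "?A1 \<subseteq> {A. A \<subseteq> ?V \<and> card A = l}"
    proof
      fix C assume "C \<in> ?A1"
      then obtain A where "A \<in> \<A>'" "x \<in> A" "C = A - {x}" by blast
      then show "C \<in> {A. A \<subseteq> ?V \<and> card A = l}"
        using A[of A] finA[of A] k by (simp add: Diff_mono)
    qed
    have B1: "?B1 \<subseteq> {B. B \<subseteq> ?V \<and> card B = k}"
    proof
      fix C assume "C \<in> ?B1"
      then obtain B where "B \<in> \<B>'" "x \<in> B" "C = B - {x}" by blast
      then show "C \<in> {B. B \<subseteq> ?V \<and> card B = k}"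
        using B[of B] finB[of B] by (simp add: Diff_mono)
    qed
    \<comment> \<open>There is no \<open>+ 1\<close> on the right: the bound \<open>del\<close> for
      the deletion has already spent the only one available.\<close>
    have link: "card ?A1 + card ?B1 + (m choose l) \<le> (m + k + 1) choose l"
    proof (cases "?B1 = {}")
      case True
      obtain B where b: "B \<in> \<B>'" "x \<notin> B" using B0 by blast
      have meet: "C \<inter> B \<noteq> {}" if "C \<in> ?A1" for C
        using that cross[OF _ b(1)] b(2) by blast
      have "B \<subseteq> ?V" using B(1)[OF b(1)] b(2) by blast
      then have "card ?A1 + ((card ?V - card B) choose l) \<le> card ?V choose l"
        by (rule card_meeting_le[OF V(1) _ A1 meet])
      moreover have "card ?B1 = 0" using True by (simp only: card.empty)
      ultimately show ?thesis using V(2) B(2)[OF b(1)] by simp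
    next
      case False
      have lp: "cross_shadow_pair ?V l ?A1 ?B1"
        unfolding cross_shadow_pair_def
      proof (intro conjI ballI)
        show "cross_intersecting ?A1 ?B1"
          unfolding cross_intersecting_def
        proof (intro ballI notI)
          fix A' B' assume "A' \<in> ?A1" "B' \<in> ?B1" and disj: "A' \<inter> B' = {}"
          then obtain A B where ab: "A \<in> \<A>'" "x \<in> A" "A' = A - {x}" "B \<in> \<B>'" "x \<in> B" "B' = B - {x}"
            by blast
          \<comment> \<open>The union has at most \<open>2 * k + 1\<close> points, so some
            \<open>i\<close> lies outside both sets. Replacing \<open>x\<close> by \<open>i\<close>
            in \<open>A\<close> stays in the family by stability, and the new set can meet
            \<open>B\<close> only within \<open>A' \<inter> B'\<close>.\<close>
          have "card (A \<union> B) < card V"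
            using card_Un_le[of A B] A(2)[OF ab(1)] B(2)[OF ab(4)] big by simp
          then obtain i where i: "i \<in> V" "i \<notin> A" "i \<notin> B"
            using card_mono[of "A \<union> B" V] finA[OF ab(1)] finB[OF ab(4)] by fastforce
          have "insert i (A - {x}) \<inter> B \<noteq> {}"
            using cross stA[OF i(1) ab(1,2) i(2)] ab(4) by blast
          then show False using disj ab i by blast
        qed
        fix B' y assume "B' \<in> ?B1" "y \<in> B'"
        then obtain B where b: "B \<in> \<B>'" "x \<in> B" "B' = B - {x}" "y \<in> B" "y \<noteq> x" by blast
        have "B' - {y} = (B - {y}) - {x}" using b by blast
        then show "B' - {y} \<in> ?A1" using sh[OF b(1,4)] b by blast
      qed (fact A1 B1[unfolded k] False)+
      have "0 < l" using lp by (rule cross_shadow_pair_pos)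
      then obtain j where j: "l = Suc j" by (cases l) auto
      \<comment> \<open>The induction hypothesis comes with a \<open>+ 1\<close>, but also with
        \<open>Suc m\<close> in place of \<open>m\<close>. By Pascal's rule this gains
        \<open>m choose j\<close>, which is at least 1 and absorbs the \<open>+ 1\<close>.\<close>
      have "card ?A1 + card ?B1 + (Suc m choose l) \<le> ((m + k + 1) choose l) + 1"
        using less.hyps[OF V(3) V(1) _ lp] V(2) m(2) k by simp
      moreover have "0 < m choose j" using j k m(2) by simp
      ultimately show ?thesis unfolding j binomial_Suc_Suc by linarith
    qed
    have "card \<A> + card \<B> = card ?A0 + card ?A1 + (card ?B0 + card ?B1)"
      using cards card_deletion_link[OF fin(1), of x] card_deletion_link[OF fin(2), of x] by simp
    moreover have "card V choose k = ((m + k + 1) choose k) + ((m + k + 1) choose l)"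
      using m(1) k by simp
    moreover have "(card V - Suc k) choose k = (m choose k) + (m choose l)"
      using m(1) k by simp
    ultimately show ?thesis using del link by linarith
  qed
qed

theorem theorem2:
  fixes k n :: nat and \<A> \<B> :: "nat set set"
  assumes "1 \<le> k" and "1 \<le> n" and "2 * k - 1 \<le> n"
    and "\<And>A. A \<in> \<A> \<Longrightarrow> A \<subseteq> {1..n} \<and> card A = k - 1"
    and "\<And>B. B \<in> \<B> \<Longrightarrow> B \<subseteq> {1..n} \<and> card B = k"
    and "cross_intersecting \<A> \<B>"
    and "\<B> \<noteq> {}"
    and "shadow \<B> \<subseteq> \<A>"
  shows "int (card \<A>) + int (card \<B>)
           \<le> int (n choose (k - 1)) - int ((n - k) choose (k - 1)) + 1"
proof -
  have "B - {y} \<in> \<A>" if "B \<in> \<B>" "y \<in> B" for B y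
  proof -
    have "finite B" using assms(5)[OF that(1)] finite_subset by blast
    then have "B - {y} \<in> set_shadow B"
      using that(2) card_Suc_Diff1[of B y] unfolding set_shadow_def by auto
    then show ?thesis using assms(8) that(1) unfolding shadow_def by blast
  qed
  then have "cross_shadow_pair {1..n} (k - 1) \<A> \<B>"
    unfolding cross_shadow_pair_def using assms(1,4-7)
    by (intro conjI subsetI[of _ "Collect _"] CollectI ballI) simp_all
  from cross_shadow_pair_card_le[OF _ _ this]
  \<comment> \<open>As \<open>1 \<le> k\<close>, here \<open>Suc (k - 1) = k\<close>, and
    \<open>2 * k - 1 \<le> n\<close> is the size condition
    \<open>2 * (k - 1) + 1 \<le> n\<close>.\<close>
  have "card \<A> + card \<B> + ((n - k) choose (k - 1)) \<le> (n choose (k - 1)) + 1"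
    using assms(1,3) by simp
  then show ?thesis by linarith
qed

end
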